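(* Let $S\subset\mathbb{R}^n$, $\bar x\in S$, $f:S\to\mathbb{R}$, let $f'(\bar x,\cdot)$ be a directional derivative of $f$ at $\bar x$ with corresponding cone $T\subseteq\mathbb{R}^n$, and let $h:T\to\mathbb{R}$, $h(g)=f'(\bar x,g)$ for all $g\in T$. Let $K$ be the negative dual cone of $T$ and let $E_*$ be a generalized lower exhauster of $h$. If $C_1,C_2\in E_*$ with $C_1\neq C_2$ and $C_1\preceq_K^{m_1}C_2$, then $\tilde E_*:=E_*\setminus\{C_2\}$ is a generalized lower exhauster of $h$.
   Context: A cone is a nonempty set $D$ with $\lambda y\in D$ for all $y\in D$, $\lambda\ge 0$. A function $h:T\to\mathbb{R}$ on a cone $T\subseteq\mathbb{R}^n$ is positively homogeneous if $h(\lambda g)=\lambda h(g)$ for all $g\in T$, $\lambda\ge 0$. The directional derivative $f'(\bar x,\cdot)$ may be taken in any sense (Dini, Hadamard, Clarke, Michel-Penot, etc.), and $T$ is the cone of directions that corresponds to the chosen derivative (for instance, for the Hadamard upper derivative $\limsup_{(\alpha,g')\to(0^+,g)}\frac1\alpha[f(\bar x+\alpha g')-f(\bar x)]$, $T$ is the contingent cone of $S$ at $\bar x$, i.e. the set of $y$ for which there are $d_k\to0^+$, $y_k\to y$ with $\bar x+d_ky_k\in S$ for all $k$). What is assumed is that $T$ is a cone in $\mathbb{R}^n$ and that $h=f'(\bar x,\cdot)$ is a real-valued positively homogeneous function on $T$. The negative dual cone of $T$ is $K=\{w\in\mathbb{R}^n:\langle w,g\rangle\le 0\ \forall g\in T\}$.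 As an ordering cone, $K$ is assumed convex, closed, pointed, containing $0$, and with nonempty interior. A generalized lower exhauster of $h:T\to\mathbb{R}$ is a family $E_*$ of nonempty closed convex subsets of $\mathbb{R}^n$ such that $h(g)=\sup_{C\in E_*}\min_{v\in C}\langle v,g\rangle$ for all $g\in T$. The Minkowski (Pontryagin) difference is $A\dot{-}B=\{x\in\mathbb{R}^n: x+B\subset A\}$. For nonempty $A,B\subset\mathbb{R}^n$, $A\preceq_K^{m_1}B$ means $(B\dot{-}A)\cap K\neq\emptyset$. *)

theory Defs
  imports "HOL-Analysis.Analysis"
begin

definition pos_homogeneous_on :: "'a::real_vector set \<Rightarrow> ('a \<Rightarrow> real) \<Rightarrow> bool" where
  "pos_homogeneous_on T h \<longleftrightarrow> (\<forall>g\<in>T. \<forall>c\<ge>0. h (c *\<^sub>R g) = c * h g)"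

definition negative_dual_cone :: "'a::real_inner set \<Rightarrow> 'a set" where
  "negative_dual_cone T = {w. \<forall>g\<in>T. w \<bullet> g \<le> 0}"

definition ordering_cone :: "'a::euclidean_space set \<Rightarrow> bool" where
  "ordering_cone K \<longleftrightarrow>
     cone K \<and> convex K \<and> closed K \<and> 0 \<in> K \<and> K \<inter> uminus ` K = {0} \<and> interior K \<noteq> {}"

text \<open>
  The minimum of each linear function over each member of the family is required to be attained;
  its value is then the infimum. The extremal values are taken in the extended reals, so that the
  equation forces the family to be nonempty and the minima to be bounded above (over the reals,
  the supremum of an empty or unbounded set is an unspecified number).
\<close>

definition gen_lower_exhauster ::
  "'a::euclidean_space set \<Rightarrow> ('a \<Rightarrow> real) \<Rightarrow> 'a set set \<Rightarrow> bool" where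
  "gen_lower_exhauster T h E \<longleftrightarrow>
     (\<forall>C\<in>E. C \<noteq> {} \<and> closed C \<and> convex C) \<and>
     (\<forall>g\<in>T. (\<forall>C\<in>E. \<exists>v\<in>C. \<forall>w\<in>C. v \<bullet> g \<le> w \<bullet> g) \<and>
             ereal (h g) = (SUP C\<in>E. INF v\<in>C. ereal (v \<bullet> g)))"

definition minkowski_diff :: "'a::ab_group_add set \<Rightarrow> 'a set \<Rightarrow> 'a set" where
  "minkowski_diff A B = {x. (\<lambda>b. x + b) ` B \<subseteq> A}"

definition m1_le :: "'a::ab_group_add set \<Rightarrow> 'a set \<Rightarrow> 'a set \<Rightarrow> bool" where
  "m1_le K A B \<longleftrightarrow> minkowski_diff B A \<inter> K \<noteq> {}"

text \<open>
  A notion of directional derivative (Dini, Hadamard, Clarke, Michel-Penot, ...) is a pair of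
  operators: \<open>dderiv S f x g\<close> is the derivative of \<open>f\<close> on \<open>S\<close> at \<open>x\<close> in direction \<open>g\<close>, and
  \<open>dirs S f x\<close> is the corresponding set of directions. Nothing is required of it except that, at
  the function and point considered, the directions form a cone on which the derivative is
  (real-valued and) positively homogeneous. Values of \<open>dderiv S f x\<close> outside \<open>dirs S f x\<close> and
  values of \<open>f\<close> outside \<open>S\<close> carry no meaning.
\<close>

definition directional_derivative_at ::
  "('a::euclidean_space set \<Rightarrow> ('a \<Rightarrow> real) \<Rightarrow> 'a \<Rightarrow> 'a \<Rightarrow> real) \<Rightarrow>
   ('a set \<Rightarrow> ('a \<Rightarrow> real) \<Rightarrow> 'a \<Rightarrow> 'a set) \<Rightarrow>
   'a set \<Rightarrow> ('a \<Rightarrow> real) \<Rightarrow> 'a \<Rightarrow> bool" where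
  "directional_derivative_at dderiv dirs S f x \<longleftrightarrow>
     dirs S f x \<noteq> {} \<and> cone (dirs S f x) \<and> pos_homogeneous_on (dirs S f x) (dderiv S f x)"

end

theory Submission
  imports Defs
begin

text \<open>
  Translating a set \<open>A\<close> by an element of the negative dual cone of \<open>T\<close> can only decrease the values
  of the linear functionals given by \<open>T\<close>. Hence, if such a translate of \<open>A\<close> lies in \<open>B\<close>, the infimum
  over \<open>B\<close> of every functional in \<open>T\<close> is at most its infimum over \<open>A\<close>
  (\<open>Inf_inner_antimono_m1_le\<close>). So \<open>C2\<close> never contributes more than \<open>C1\<close> to the supremum of minima
  that represents \<open>h\<close>, and since \<open>C1\<close> stays in the family, removing \<open>C2\<close> leaves that supremum
  unchanged (\<open>SUP_remove_dominated\<close>).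
\<close>

lemma SUP_remove_dominated:
  fixes F :: "'i \<Rightarrow> 'b::complete_lattice"
  assumes "i \<in> I" and "i \<noteq> j" and "F j \<le> F i"
  shows "(SUP k\<in>I - {j}. F k) = (SUP k\<in>I. F k)"
proof (rule antisym)
  show "(SUP k\<in>I - {j}. F k) \<le> (SUP k\<in>I. F k)"
    by (rule SUP_subset_mono) auto
  show "(SUP k\<in>I. F k) \<le> (SUP k\<in>I - {j}. F k)"
  proof (rule SUP_mono)
    fix k assume "k \<in> I"
    then show "\<exists>m\<in>I - {j}. F k \<le> F m"
      using assms by (cases "k = j") auto
  qed
qed

lemma Inf_inner_antimono_m1_le:
  assumes "m1_le (negative_dual_cone T) A B" and "g \<in> T"
  shows "(INF v\<in>B. ereal (v \<bullet> g)) \<le> (INF v\<in>A. ereal (v \<bullet> g))"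
proof -
  obtain k where k: "k \<in> negative_dual_cone T" and sub: "(\<lambda>a. k + a) ` A \<subseteq> B"
    using assms(1) by (auto simp: m1_le_def minkowski_diff_def)
  have "k \<bullet> g \<le> 0"
    using k assms(2) by (simp add: negative_dual_cone_def)
  show ?thesis
  proof (rule INF_mono)
    fix a assume "a \<in> A"
    then have "k + a \<in> B" using sub by blast
    moreover have "ereal ((k + a) \<bullet> g) \<le> ereal (a \<bullet> g)"
      using \<open>k \<bullet> g \<le> 0\<close> by (simp add: inner_add_left)
    ultimately show "\<exists>b\<in>B. ereal (b \<bullet> g) \<le> ereal (a \<bullet> g)" by blast
  qed
qed

theorem theorem3p1:
  fixes S :: "(real ^ 'n) set" and xbar :: "real ^ 'n" and f :: "real ^ 'n \<Rightarrow> real"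
    and dderiv :: "(real ^ 'n) set \<Rightarrow> (real ^ 'n \<Rightarrow> real) \<Rightarrow> real ^ 'n \<Rightarrow> real ^ 'n \<Rightarrow> real"
    and dirs :: "(real ^ 'n) set \<Rightarrow> (real ^ 'n \<Rightarrow> real) \<Rightarrow> real ^ 'n \<Rightarrow> (real ^ 'n) set"
    and T K :: "(real ^ 'n) set" and h :: "real ^ 'n \<Rightarrow> real"
    and E :: "(real ^ 'n) set set" and C1 C2 :: "(real ^ 'n) set"
  assumes "xbar \<in> S"
    and "directional_derivative_at dderiv dirs S f xbar"
    and "T = dirs S f xbar"
    and "\<forall>g\<in>T. h g = dderiv S f xbar g"
    and "K = negative_dual_cone T"
    and "ordering_cone K"
    and "gen_lower_exhauster T h E"
    and "C1 \<in> E" and "C2 \<in> E" and "C1 \<noteq> C2"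
    and "m1_le K C1 C2"
  shows "gen_lower_exhauster T h (E - {C2})"
proof -
  have "(SUP C\<in>E - {C2}. INF v\<in>C. ereal (v \<bullet> g)) = (SUP C\<in>E. INF v\<in>C. ereal (v \<bullet> g))"
    if "g \<in> T" for g
    using assms that by (intro SUP_remove_dominated Inf_inner_antimono_m1_le) auto
  then show ?thesis
    using \<open>gen_lower_exhauster T h E\<close> by (simp add: gen_lower_exhauster_def)
qed

end
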